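(* Let $M\in\mathbb{C}^{p\times p}$ be nonsingular and let $\mathcal{A},\mathcal{B}\in\mathbb{C}^{m\times m\times p}$ have tubal indices $k_1$ and $k_2$, respectively. If $\mathcal{A}*_M\mathcal{B}=\mathcal{B}*_M\mathcal{A}=\mathcal{O}=\mathcal{A}^**_M\mathcal{B}$, then $(\mathcal{A}+\mathcal{B})^{\mathrm{cep}}=\mathcal{A}^{\mathrm{cep}}+\mathcal{B}^{\mathrm{cep}}$ and $(\mathcal{A}-\mathcal{B})^{\mathrm{cep}}=\mathcal{A}^{\mathrm{cep}}-\mathcal{B}^{\mathrm{cep}}$.
   Context: Transform: for $\mathcal{A}\in\mathbb{C}^{m\times n\times p}$, $\tilde{\mathcal{A}}=\mathcal{A}\times_3 M\in\mathbb{C}^{m\times n\times p}$ is given by $(\tilde{\mathcal{A}})_{ijk}=\sum_{s=1}^p(\mathcal{A})_{ijs}M_{ks}$, and $\tilde{\mathcal{A}}^{(i)}=\tilde{\mathcal{A}}(:,:,i)$ is its $i$th frontal slice. Since $M$ is nonsingular, $\mathcal{A}\mapsto\tilde{\mathcal{A}}$ is a bijection. $M$-product: for $\mathcal{A}\in\mathbb{C}^{m\times n\times p}$, $\mathcal{B}\in\mathbb{C}^{n\times l\times p}$, $\mathcal{A}*_M\mathcal{B}$ is the unique $\mathcal{C}\in\mathbb{C}^{m\times l\times p}$ with $\tilde{\mathcal{C}}^{(i)}=\tilde{\mathcal{A}}^{(i)}\tilde{\mathcal{B}}^{(i)}$, $i=1,\dots,p$. The identity tensor $\mathcal{I}$ has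 $\tilde{\mathcal{I}}^{(i)}=I_m$ for all $i$; $\mathcal{O}$ is the zero tensor; powers are taken with respect to $*_M$, with $\mathcal{A}^0=\mathcal{I}$. The conjugate transpose $\mathcal{A}^*$ is the tensor whose transform has $i$th frontal slice $(\tilde{\mathcal{A}}^{(i)})^{*}$ (matrix conjugate transpose). Tubal index of $\mathcal{A}\in\mathbb{C}^{m\times m\times p}$: $k=\max_{1\le i\le p}\mathrm{ind}(\tilde{\mathcal{A}}^{(i)})$, where $\mathrm{ind}(A)$ is the least integer $k\ge 0$ with $\mathrm{rank}(A^k)=\mathrm{rank}(A^{k+1})$. Core-EP inverse: for $\mathcal{A}\in\mathbb{C}^{m\times m\times p}$ of tubal index $k$, $\mathcal{A}^{\mathrm{cep}}$ is the tensor $\mathcal{X}\in\mathbb{C}^{m\times m\times p}$ satisfying $\mathcal{X}*_M\mathcal{A}^{k+1}=\mathcal{A}^k$, $\mathcal{A}*_M\mathcal{X}^2=\mathcal{X}$ and $(\mathcal{A}*_M\mathcal{X})^*=\mathcal{A}*_M\mathcal{X}$. *)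

theory Defs
  imports "HOL-Analysis.Analysis"
begin

section \<open>Matrices\<close>

text \<open>The power operator of the library acts entrywise on the vector types,
  hence a separate power for the matrix product.\<close>

primrec mat_pow :: "complex^'m^'m \<Rightarrow> nat \<Rightarrow> complex^'m^'m" where
  "mat_pow A 0 = mat 1"
| "mat_pow A (Suc n) = A ** mat_pow A n"

definition conj_transpose :: "complex^'n^'m \<Rightarrow> complex^'m^'n" where
  "conj_transpose A = (\<chi> i j. cnj (A $ j $ i))"

definition mat_ind :: "complex^'m^'m \<Rightarrow> nat" where
  "mat_ind A = (LEAST k. rank (mat_pow A k) = rank (mat_pow A (Suc k)))"


section \<open>Third-order tensors and the transform\<close>

text \<open>An \<open>m \<times> n \<times> p\<close> tensor has type \<open>complex^'p^'n^'m\<close>: its entry at position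
  \<open>(i, j, k)\<close> is \<open>A $ i $ j $ k\<close>.\<close>

definition transform :: "complex^'p^'p \<Rightarrow> complex^'p^'n^'m \<Rightarrow> complex^'p^'n^'m" where
  "transform M A = (\<chi> i j k. \<Sum>s\<in>UNIV. A $ i $ j $ s * M $ k $ s)"

definition frontal_slice :: "complex^'p^'n^'m \<Rightarrow> 'p \<Rightarrow> complex^'n^'m" where
  "frontal_slice A k = (\<chi> i j. A $ i $ j $ k)"

abbreviation tslice :: "complex^'p^'p \<Rightarrow> complex^'p^'n^'m \<Rightarrow> 'p \<Rightarrow> complex^'n^'m" where
  "tslice M A k \<equiv> frontal_slice (transform M A) k"

lemma ex1_tslice:
  fixes M :: "complex^'p^'p" and S :: "'p \<Rightarrow> complex^'n^'m"
  assumes "invertible M"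
  shows "\<exists>!C :: complex^'p^'n^'m. \<forall>k. tslice M C k = S k"
proof -
  have tr: "(\<forall>k. tslice M C k = S k) \<longleftrightarrow> (\<forall>i j. M *v (C $ i $ j) = (\<chi> k. S k $ i $ j))"
    for C :: "complex^'p^'n^'m"
    by (auto simp: vec_eq_iff transform_def frontal_slice_def matrix_vector_mult_def mult.commute)
  obtain N where N: "M ** N = mat 1" "N ** M = mat 1"
    using assms by (auto simp: invertible_def)
  have inv: "M *v x = y \<longleftrightarrow> x = N *v y" for x y
    using N by (metis matrix_vector_mul_assoc matrix_vector_mul_lid)
  have "(\<forall>k. tslice M C k = S k) \<longleftrightarrow> C = (\<chi> i j. N *v (\<chi> k. S k $ i $ j))"
    for C :: "complex^'p^'n^'m"
    unfolding tr inv by (auto simp: vec_eq_iff)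
  then show ?thesis by simp
qed


section \<open>The M-product and its operations\<close>

text \<open>The descriptions below are meaningful when \<open>M\<close> is invertible.\<close>

definition mprod ::
  "complex^'p^'p \<Rightarrow> complex^'p^'n^'m \<Rightarrow> complex^'p^'l^'n \<Rightarrow> complex^'p^'l^'m" where
  "mprod M A B = (THE C. \<forall>k. tslice M C k = tslice M A k ** tslice M B k)"

definition mident :: "complex^'p^'p \<Rightarrow> complex^'p^'m^'m" where
  "mident M = (THE C. \<forall>k. tslice M C k = mat 1)"

definition mctrans :: "complex^'p^'p \<Rightarrow> complex^'p^'n^'m \<Rightarrow> complex^'p^'m^'n" where
  "mctrans M A = (THE C. \<forall>k. tslice M C k = conj_transpose (tslice M A k))"

primrec mpow :: "complex^'p^'p \<Rightarrow> complex^'p^'m^'m \<Rightarrow> nat \<Rightarrow> complex^'p^'m^'m" where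
  "mpow M A 0 = mident M"
| "mpow M A (Suc n) = mprod M A (mpow M A n)"

lemma tslice_mprod:
  "invertible M \<Longrightarrow> tslice M (mprod M A B) k = tslice M A k ** tslice M B k"
  unfolding mprod_def by (rule theI'[OF ex1_tslice, THEN spec])

lemma tslice_mident: "invertible M \<Longrightarrow> tslice M (mident M) k = mat 1"
  unfolding mident_def by (rule theI'[OF ex1_tslice, THEN spec])

lemma tslice_mctrans:
  "invertible M \<Longrightarrow> tslice M (mctrans M A) k = conj_transpose (tslice M A k)"
  unfolding mctrans_def by (rule theI'[OF ex1_tslice, THEN spec])


section \<open>Tubal index and core-EP inverse\<close>

definition tubal_index :: "complex^'p^'p \<Rightarrow> complex^'p^'m^'m \<Rightarrow> nat" where
  "tubal_index M A = Max (range (\<lambda>i. mat_ind (tslice M A i)))"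

definition is_core_EP_inverse ::
  "complex^'p^'p \<Rightarrow> complex^'p^'m^'m \<Rightarrow> complex^'p^'m^'m \<Rightarrow> bool" where
  "is_core_EP_inverse M A X \<longleftrightarrow>
     mprod M X (mpow M A (tubal_index M A + 1)) = mpow M A (tubal_index M A) \<and>
     mprod M A (mpow M X 2) = X \<and>
     mctrans M (mprod M A X) = mprod M A X"

definition core_EP_inverse ::
  "complex^'p^'p \<Rightarrow> complex^'p^'m^'m \<Rightarrow> complex^'p^'m^'m" where
  "core_EP_inverse M A = (THE X. is_core_EP_inverse M A X)"

end

theory Submission
  imports Defs
begin

text \<open>
  The transform turns every tensor operation into the corresponding matrix operation on each
  transformed frontal slice, so the statement is one about matrices. The one thing that does not
  split over the slices is the tubal index: the equation \<open>X A\<^bsup>k+1\<^esup> = A\<^bsup>k\<^esup>\<close> is required in every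
  slice for the same \<open>k\<close>, the maximum of the indices of the slices. Moreover the index of \<open>A + B\<close>
  is not known beforehand. Both difficulties vanish because the value of \<open>k\<close> is immaterial:
  the equation for one \<open>k\<close> implies it for every \<open>k\<close> that is at least the index of \<open>A\<close>,
  since there the powers of \<open>A\<close> all have the same column space
  (\<open>core_EP_mat_pow_beyond_ind\<close>). The matrix notion \<open>core_EP_mat\<close> therefore asks for some \<open>k\<close>.

  For matrices, let \<open>X\<close> and \<open>Y\<close> be the core-EP inverses of \<open>A\<close> and \<open>B\<close>. Since \<open>X = X (A X)\<close> and
  \<open>A X\<close> is Hermitian, \<open>X B = X (A X)\<^sup>* B = X X\<^sup>* (A\<^sup>* B) = 0\<close>, and likewise \<open>Y A = 0\<close>. From
  \<open>X = A X\<^sup>2\<close> and \<open>Y = B Y\<^sup>2\<close> one gets \<open>A Y = B X = 0\<close>, and then \<open>X Y = Y X = 0\<close>. So all mixed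
  products vanish, the defining equations of \<open>X\<close> and \<open>Y\<close> add up, and \<open>X + Y\<close> is a core-EP inverse
  of \<open>A + B\<close> (\<open>core_EP_mat_add\<close>). The statement on differences is the one on sums for \<open>- B\<close>, whose
  core-EP inverse is \<open>- Y\<close>.

  Because the core-EP inverse is given by a definite description, its existence and uniqueness are
  part of the proof. For existence let \<open>k\<close> be the index of \<open>A\<close> and choose \<open>Z\<close> such that
  \<open>A\<^bsup>k+1\<^esup> Z\<close> is the orthogonal projector onto the column space of \<open>A\<^bsup>k+1\<^esup>\<close>; then \<open>X = A\<^bsup>k\<^esup> Z\<close> works.
  For uniqueness, \<open>A X\<close> and \<open>A Y\<close> are Hermitian idempotents with the same column space, hence equal.
\<close>

section \<open>Factoring matrices over a field\<close>

text \<open>The rank is by definition the dimension of the row space. Describing that space as a range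
  allows the rank to be compared for products over any field.\<close>

lemma rank_dim_row_space:
  fixes A :: "'a::field^'n^'m"
  shows "rank A = vec.dim (range ((*v) (transpose A)))"
proof -
  have "vec.span (rows A) = range ((*v) (transpose A))"
  proof
    have "row i A \<in> range ((*v) (transpose A))" for i
    proof
      show "row i A = transpose A *v axis i 1"
        by (simp add: vec_eq_iff row_def transpose_def matrix_vector_mult_def axis_def if_distrib
            cong: if_cong)
    qed simp
    then show "vec.span (rows A) \<subseteq> range ((*v) (transpose A))"
      by (intro vec.span_minimal vec.subspace_image) (auto simp: rows_def)
    show "range ((*v) (transpose A)) \<subseteq> vec.span (rows A)"
      using matrix_vector_mult_in_columnspace_gen[of "transpose A"] by auto
  qed
  then show ?thesis
    unfolding row_rank_def_gen by (metis vec.dim_span)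
qed

lemma row_space_mult_subset:
  fixes C :: "'a::field^'n^'l" and D :: "'a^'m^'n"
  shows "range ((*v) (transpose (C ** D))) \<subseteq> range ((*v) (transpose D))"
  by (auto simp: matrix_transpose_mul matrix_vector_mul_assoc[symmetric])

lemma rank_mult_le_right_field:
  fixes C :: "'a::field^'n^'l" and D :: "'a^'m^'n"
  shows "rank (C ** D) \<le> rank D"
  unfolding rank_dim_row_space by (intro vec.dim_subset row_space_mult_subset)

text \<open>A linear right inverse of \<open>D\<close> on its column space; it turns inclusions of kernels and of
  column spaces into factorizations of matrices.\<close>

lemma inner_inverse_exists:
  fixes D :: "'a::field^'n^'m"
  shows "\<exists>Y. D ** Y ** D = D"
proof -
  obtain g where g: "Vector_Spaces.linear (*s) (*s) g" "\<forall>v\<in>range ((*v) D). D *v g v = v"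
    using vec.linear_exists_right_inverse_on[OF matrix_vector_mul_linear_gen vec.subspace_UNIV, of D]
    by auto
  have "D ** matrix g ** D = D"
    by (auto simp: matrix_eq matrix_works[OF g(1)] g(2) simp flip: matrix_vector_mul_assoc)
  then show ?thesis ..
qed

lemma factor_if_range_subset:
  fixes C :: "'a::field^'n^'m" and D :: "'a^'l^'m"
  assumes "range ((*v) C) \<subseteq> range ((*v) D)"
  shows "\<exists>W. C = D ** W"
proof -
  obtain Y where Y: "D ** Y ** D = D" using inner_inverse_exists by blast
  have "C *v x = (D ** (Y ** C)) *v x" for x
  proof -
    obtain y where "C *v x = D *v y" using assms by blast
    then show ?thesis using Y by (metis matrix_mul_assoc matrix_vector_mul_assoc)
  qed
  then show ?thesis by (metis matrix_eq)
qed

lemma factor_if_kernel_subset: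
  fixes C :: "'a::field^'n^'m" and D :: "'a^'n^'l"
  assumes "\<And>x. D *v x = 0 \<Longrightarrow> C *v x = 0"
  shows "\<exists>V. C = V ** D"
proof -
  obtain Y where Y: "D ** Y ** D = D" using inner_inverse_exists by blast
  have "C *v x = (C ** Y ** D) *v x" for x
  proof -
    have "D *v (x - (Y ** D) *v x) = 0"
      using Y by (simp add: matrix_vector_mult_diff_distrib matrix_vector_mul_assoc matrix_mul_assoc)
    then have "C *v (x - (Y ** D) *v x) = 0" by (rule assms)
    then show ?thesis
      by (simp add: matrix_vector_mult_diff_distrib matrix_vector_mul_assoc matrix_mul_assoc)
  qed
  then show ?thesis by (metis matrix_eq)
qed

text \<open>The row space of \<open>C D\<close> lies in that of \<open>D\<close>, so equal dimensions force equality, and every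
  row of \<open>D\<close> is a combination of rows of \<open>C D\<close>.\<close>

lemma left_factor_if_rank_mult_eq:
  fixes C :: "'a::field^'n^'l" and D :: "'a^'m^'n"
  assumes "rank (C ** D) = rank D"
  shows "\<exists>V. D = V ** (C ** D)"
proof -
  have "range ((*v) (transpose (C ** D))) = range ((*v) (transpose D))"
    using assms unfolding rank_dim_row_space
    by (intro vec.subspace_dim_equal vec.subspace_image vec.subspace_UNIV row_space_mult_subset) auto
  then obtain W where "transpose D = transpose (C ** D) ** W"
    using factor_if_range_subset[of "transpose D" "transpose (C ** D)"] by auto
  then have "D = transpose W ** (C ** D)"
    by (metis matrix_transpose_mul transpose_transpose)
  then show ?thesis ..
qed

text \<open>The left factorization says that \<open>C\<close> is injective on the column space of \<open>D\<close>, and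
  commutation that \<open>C\<close> maps this space into itself. The space has finite dimension, so \<open>C\<close> maps it
  onto itself, that is, \<open>C D\<close> has the same column space as \<open>D\<close>.\<close>

lemma right_factor_if_left_factor:
  fixes C D :: "'a::field^'n^'n"
  assumes comm: "C ** D = D ** C" and V: "D = V ** (C ** D)"
  shows "\<exists>W. D = C ** D ** W"
proof -
  have inj: "inj_on ((*v) C) (range ((*v) D))"
    using V by (auto intro!: inj_onI) (metis matrix_vector_mul_assoc)
  have img: "(*v) C ` range ((*v) D) = range ((*v) (C ** D))"
    by (auto simp: matrix_vector_mul_assoc image_image)
  have span: "vec.span (range ((*v) D)) = range ((*v) D)"
    by (simp add: vec.subspace_image vec.span_eq_iff)
  have "vec.dim (range ((*v) (C ** D))) = vec.dim (range ((*v) D))"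
    using vec.dim_image_eq[OF matrix_vector_mul_linear_gen, of C "range ((*v) D)"] inj img span
    by simp
  moreover have "range ((*v) (C ** D)) \<subseteq> range ((*v) D)"
    unfolding comm by (auto simp: matrix_vector_mul_assoc[symmetric])
  ultimately have "range ((*v) (C ** D)) = range ((*v) D)"
    by (intro vec.subspace_dim_equal vec.subspace_image vec.subspace_UNIV) auto
  then show ?thesis by (intro factor_if_range_subset) simp
qed


section \<open>Powers and the index of a matrix\<close>

lemma mat_pow_add: "mat_pow A (m + n) = mat_pow A m ** mat_pow A n"
  by (induction m) (simp_all add: matrix_mul_assoc)

lemma mat_pow_Suc_right: "mat_pow A (Suc n) = mat_pow A n ** A"
  using mat_pow_add[of A n "Suc 0"] by simp

text \<open>The ranks of the powers cannot decrease forever, so the index is attained.\<close>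

lemma rank_mat_pow_mat_ind: "rank (mat_pow A (mat_ind A)) = rank (mat_pow A (Suc (mat_ind A)))"
proof -
  have "\<exists>k. rank (mat_pow A k) = rank (mat_pow A (Suc k))"
  proof (rule ccontr)
    assume "\<nexists>k. rank (mat_pow A k) = rank (mat_pow A (Suc k))"
    then have less: "rank (mat_pow A (Suc k)) < rank (mat_pow A k)" for k
      using rank_mult_le_right_field[of A "mat_pow A k"] by (simp add: nat_less_le) metis
    have "rank (mat_pow A k) + k \<le> rank (mat_pow A 0)" for k
    proof (induction k)
      case (Suc k)
      then show ?case using less[of k] by linarith
    qed simp
    from this[of "Suc (rank (mat_pow A 0))"] show False by simp
  qed
  then show ?thesis unfolding mat_ind_def by (rule LeastI_ex)
qed

text \<open>At the index both the row space and the column space of the powers stabilize. The column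
  space is what makes the defining equation independent of the exponent, the row space is used to
  construct the inverse.\<close>

lemma mat_pow_ind_factors:
  obtains V W where "mat_pow A (mat_ind A) = V ** mat_pow A (Suc (mat_ind A))"
    and "mat_pow A (mat_ind A) = mat_pow A (Suc (mat_ind A)) ** W"
proof -
  let ?D = "mat_pow A (mat_ind A)"
  obtain V where V: "?D = V ** (A ** ?D)"
    using left_factor_if_rank_mult_eq[of A ?D] rank_mat_pow_mat_ind[of A] by auto
  moreover obtain W where "?D = A ** ?D ** W"
    using right_factor_if_left_factor[OF mat_pow_Suc_right[of A "mat_ind A", simplified] V] by blast
  ultimately show thesis using that[of V W] unfolding mat_pow.simps by blast
qed

lemma mat_pow_factor_beyond_ind:
  assumes "mat_ind A \<le> k"
  shows "\<exists>W. mat_pow A k = mat_pow A (k + n) ** W"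
proof (induction n)
  case 0
  show ?case by (metis add_0_right matrix_mul_rid)
next
  case (Suc n)
  obtain W where W: "mat_pow A k = mat_pow A (k + n) ** W" using Suc by blast
  obtain U where U: "mat_pow A (mat_ind A) = mat_pow A (Suc (mat_ind A)) ** U"
    using mat_pow_ind_factors by metis
  obtain d where d: "k + n = d + mat_ind A"
    using assms by (metis le_add_diff_inverse2 le_add1 order_trans)
  have "mat_pow A (k + n) = mat_pow A (Suc (k + n)) ** U"
    using U unfolding d by (metis add_Suc_right mat_pow_add matrix_mul_assoc)
  then show ?case using W by (metis add_Suc_right matrix_mul_assoc)
qed

lemma mat_pow_uminus:
  "mat_pow (- A) n = (if even n then mat_pow A n else - mat_pow A n)"
proof (induction n)
  case (Suc n)
  then show ?case
    by (simp add: matrix_matrix_mult_def vec_eq_iff sum_negf)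
qed simp


section \<open>The conjugate transpose\<close>

lemma conj_transpose_mult: "conj_transpose (A ** B) = conj_transpose B ** conj_transpose A"
  by (simp add: conj_transpose_def matrix_matrix_mult_def vec_eq_iff mult.commute)

lemma conj_transpose_conj_transpose [simp]: "conj_transpose (conj_transpose A) = A"
  by (simp add: conj_transpose_def vec_eq_iff)

lemma conj_transpose_add: "conj_transpose (A + B) = conj_transpose A + conj_transpose B"
  by (simp add: conj_transpose_def vec_eq_iff)

lemma conj_transpose_0 [simp]: "conj_transpose 0 = 0"
  by (simp add: conj_transpose_def vec_eq_iff)

text \<open>If \<open>A\<^sup>* A x = 0\<close>, then \<open>0 = x\<^sup>* A\<^sup>* A x\<close>, which is the squared norm of \<open>A x\<close>.\<close>

lemma gram_kernel:
  fixes A :: "complex^'n^'m"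
  assumes "(conj_transpose A ** A) *v x = 0"
  shows "A *v x = 0"
proof -
  let ?y = "A *v x"
  have "0 = (\<Sum>j\<in>UNIV. cnj (x $ j) * (conj_transpose A *v ?y) $ j)"
    using assms by (simp add: matrix_vector_mul_assoc)
  also have "\<dots> = (\<Sum>j\<in>UNIV. \<Sum>i\<in>UNIV. cnj (A $ i $ j * x $ j) * ?y $ i)"
    unfolding matrix_vector_mult_def[of "conj_transpose A"]
    by (simp add: conj_transpose_def sum_distrib_left mult_ac)
  also have "\<dots> = (\<Sum>i\<in>UNIV. \<Sum>j\<in>UNIV. cnj (A $ i $ j * x $ j) * ?y $ i)"
    by (rule sum.swap)
  also have "\<dots> = (\<Sum>i\<in>UNIV. cnj (?y $ i) * ?y $ i)"
    by (simp add: matrix_vector_mult_def sum_distrib_right)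
  also have "\<dots> = of_real (\<Sum>i\<in>UNIV. (cmod (?y $ i))\<^sup>2)"
    by (simp add: complex_norm_square mult.commute del: of_real_power)
  finally have "(\<Sum>i\<in>UNIV. (cmod (?y $ i))\<^sup>2) = 0"
    by (metis of_real_eq_0_iff)
  then show ?thesis
    by (simp add: sum_nonneg_eq_0_iff vec_eq_iff)
qed

text \<open>Since \<open>D\<^sup>* D\<close> has the kernel of \<open>D\<close>, one can write \<open>D = V D\<^sup>* D\<close>. With \<open>P = V D\<^sup>*\<close> this
  reads \<open>P D = D\<close>, hence \<open>P P\<^sup>* = P D V\<^sup>* = P\<^sup>*\<close>. The left side is Hermitian, so \<open>P = P\<^sup>* = D V\<^sup>*\<close> is
  the orthogonal projector onto the column space of \<open>D\<close>.\<close>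

lemma orthogonal_projector_onto_range:
  fixes D :: "complex^'n^'m"
  shows "\<exists>Z. conj_transpose (D ** Z) = D ** Z \<and> D ** Z ** D = D"
proof -
  obtain V where V: "D = V ** (conj_transpose D ** D)"
    using factor_if_kernel_subset[of "conj_transpose D ** D" D] gram_kernel by blast
  let ?P = "V ** conj_transpose D"
  have PD: "?P ** D = D" using V by (simp add: matrix_mul_assoc)
  have "?P ** conj_transpose ?P = conj_transpose ?P"
    using PD by (simp add: conj_transpose_mult matrix_mul_assoc)
  then have "conj_transpose ?P = ?P"
    by (metis conj_transpose_conj_transpose conj_transpose_mult)
  then show ?thesis
    using PD by (intro exI[of _ "conj_transpose V"]) (simp add: conj_transpose_mult)
qed


section \<open>The core-EP inverse of a matrix\<close>

text \<open>The exponent is existentially quantified instead of being the index of \<open>A\<close>, so that the same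
  notion fits all slices of a tensor, whatever the tubal index is.\<close>

definition core_EP_mat :: "complex^'m^'m \<Rightarrow> complex^'m^'m \<Rightarrow> bool" where
  "core_EP_mat A X \<longleftrightarrow>
     (\<exists>n. X ** mat_pow A (Suc n) = mat_pow A n) \<and>
     A ** X ** X = X \<and>
     conj_transpose (A ** X) = A ** X"

lemma core_EP_mat_pow_mono:
  assumes "X ** mat_pow A (Suc n) = mat_pow A n" and "n \<le> k"
  shows "X ** mat_pow A (Suc k) = mat_pow A k"
  using assms by (metis add_Suc le_add_diff_inverse mat_pow_add matrix_mul_assoc)

text \<open>An exponent at which the equation holds may well exceed \<open>k\<close>. To come down to \<open>k\<close>, write
  \<open>A\<^bsup>k\<^esup> = A\<^bsup>k+n\<^esup> W\<close> and multiply the equation at \<open>k + n\<close> by \<open>W\<close>.\<close>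

lemma core_EP_mat_pow_beyond_ind:
  assumes "core_EP_mat A X" and "mat_ind A \<le> k"
  shows "X ** mat_pow A (Suc k) = mat_pow A k"
proof -
  obtain n where n: "X ** mat_pow A (Suc n) = mat_pow A n"
    using assms(1) by (auto simp: core_EP_mat_def)
  obtain W where W: "mat_pow A k = mat_pow A (k + n) ** W"
    using mat_pow_factor_beyond_ind[OF assms(2)] by blast
  have "X ** mat_pow A (Suc (k + n)) = mat_pow A (k + n)"
    using core_EP_mat_pow_mono[OF n] by simp
  moreover have "mat_pow A (Suc k) = mat_pow A (Suc (k + n)) ** W"
    using W by (simp add: matrix_mul_assoc[symmetric])
  ultimately show ?thesis using W by (simp add: matrix_mul_assoc del: mat_pow.simps)
qed

lemma mult_eq_pow_mult_pow:
  assumes "A ** X ** X = X"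
  shows "X = mat_pow A n ** mat_pow X (Suc n)"
proof (induction n)
  case (Suc n)
  have "mat_pow A (Suc n) ** mat_pow X (Suc (Suc n)) = mat_pow A n ** (A ** X ** X) ** mat_pow X n"
    by (simp add: mat_pow_Suc_right[of A] matrix_mul_assoc del: mat_pow.simps(2))
      (simp add: matrix_mul_assoc)
  also have "\<dots> = mat_pow A n ** mat_pow X (Suc n)"
    using assms by (simp add: matrix_mul_assoc[symmetric])
  finally show ?case using Suc by simp
qed simp

text \<open>Iterating \<open>T = A T\<^sup>2\<close> shows \<open>T = A\<^bsup>n\<^esup> T\<^bsup>n+1\<^esup>\<close>, and \<open>U\<close> cancels one factor of \<open>A\<^bsup>n+1\<^esup>\<close>. For
  \<open>U = T\<close> this says that \<open>T\<close> is an outer inverse of \<open>A\<close>.\<close>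

lemma core_EP_mat_absorb:
  assumes U: "core_EP_mat A U" and T: "core_EP_mat A T"
  shows "U ** (A ** T) = T"
proof -
  define n where "n = mat_ind A"
  have T': "T = mat_pow A n ** mat_pow T (Suc n)"
    using T by (intro mult_eq_pow_mult_pow) (simp add: core_EP_mat_def)
  then have "U ** (A ** T) = U ** (A ** (mat_pow A n ** mat_pow T (Suc n)))"
    by simp
  also have "\<dots> = (U ** mat_pow A (Suc n)) ** mat_pow T (Suc n)"
    by (simp add: matrix_mul_assoc)
  also have "\<dots> = T"
    using core_EP_mat_pow_beyond_ind[OF U, of n] T' by (simp add: n_def)
  finally show ?thesis .
qed

text \<open>The projectors \<open>P = A X\<close> and \<open>Q = A Y\<close> satisfy \<open>P Q = Q\<close> and \<open>Q P = P\<close>. As both are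
  Hermitian, taking adjoints in \<open>P Q = Q\<close> gives \<open>Q P = Q\<close>, so \<open>P = Q\<close>; then
  \<open>X = X (A X) = X (A Y) = Y\<close>.\<close>

lemma core_EP_mat_unique:
  assumes X: "core_EP_mat A X" and Y: "core_EP_mat A Y"
  shows "X = Y"
proof -
  have "A ** X = A ** Y"
  proof -
    have "(A ** X) ** (A ** Y) = A ** Y" "(A ** Y) ** (A ** X) = A ** X"
      using core_EP_mat_absorb[OF X Y] core_EP_mat_absorb[OF Y X]
      by (simp_all add: matrix_mul_assoc[symmetric])
    then show ?thesis
      using X Y unfolding core_EP_mat_def by (metis conj_transpose_mult)
  qed
  then show ?thesis using core_EP_mat_absorb X Y by metis
qed

lemma core_EP_mat_exists: "\<exists>X. core_EP_mat A X"
proof -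
  define k where "k = mat_ind A"
  obtain V W where V: "mat_pow A k = V ** mat_pow A (Suc k)"
    and W: "mat_pow A k = mat_pow A (Suc k) ** W"
    unfolding k_def by (rule mat_pow_ind_factors)
  obtain Z where Z: "conj_transpose (mat_pow A (Suc k) ** Z) = mat_pow A (Suc k) ** Z"
    "mat_pow A (Suc k) ** Z ** mat_pow A (Suc k) = mat_pow A (Suc k)"
    using orthogonal_projector_onto_range by blast
  define X where "X = mat_pow A k ** Z"
  have AX: "A ** X = mat_pow A (Suc k) ** Z"
    by (simp add: X_def matrix_mul_assoc)
  \<comment> \<open>The projector \<open>A X\<close> fixes the columns of \<open>A\<^bsup>k\<^esup>\<close> because they lie in the column space of
    \<open>A\<^bsup>k+1\<^esup>\<close>.\<close>
  have "A ** X ** mat_pow A k = mat_pow A k"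
    unfolding AX using W Z(2) by (metis matrix_mul_assoc)
  then have "A ** X ** X = X"
    by (metis X_def matrix_mul_assoc)
  moreover have "X ** mat_pow A (Suc k) = mat_pow A k"
  proof -
    have "X ** mat_pow A (Suc k) = V ** (mat_pow A (Suc k) ** Z ** mat_pow A (Suc k))"
      unfolding X_def using V by (metis matrix_mul_assoc)
    then show ?thesis using V Z(2) by metis
  qed
  ultimately show ?thesis
    using AX Z(1) unfolding core_EP_mat_def by metis
qed

lemma core_EP_mat_uminus:
  assumes "core_EP_mat A X"
  shows "core_EP_mat (- A) (- X)"
proof -
  have neg: "- S ** T = - (S ** T)" "S ** - T = - (S ** T)" for S T :: "complex^'m^'m"
    by (simp_all add: matrix_matrix_mult_def vec_eq_iff sum_negf)
  obtain n where "X ** mat_pow A (Suc n) = mat_pow A n"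
    using assms by (auto simp: core_EP_mat_def)
  then have "- X ** mat_pow (- A) (Suc n) = mat_pow (- A) n"
    by (simp add: mat_pow_uminus neg del: mat_pow.simps)
  then show ?thesis
    using assms unfolding core_EP_mat_def by (auto simp: neg)
qed

lemma matrix_mult_add_left: "(A + B) ** C = A ** C + B ** C"
  for A B :: "'a::semiring_1^'n^'m"
  by (simp add: matrix_matrix_mult_def vec_eq_iff distrib_right sum.distrib)

lemma core_EP_mat_add:
  assumes X: "core_EP_mat A X" and Y: "core_EP_mat B Y"
    and AB: "A ** B = 0" and BA: "B ** A = 0" and orth: "conj_transpose A ** B = 0"
  shows "core_EP_mat (A + B) (X + Y)"
proof -
  note distrib = matrix_add_ldistrib matrix_mult_add_left
  have AX: "A ** X ** X = X" "conj_transpose (A ** X) = A ** X"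
    and BY: "B ** Y ** Y = Y" "conj_transpose (B ** Y) = B ** Y"
    using X Y by (simp_all add: core_EP_mat_def)
  have XE: "X = X ** (A ** X)" and YE: "Y = Y ** (B ** Y)"
    using core_EP_mat_absorb X Y by metis+
  have "A ** X ** B = conj_transpose X ** (conj_transpose A ** B)"
    by (metis AX(2) conj_transpose_mult matrix_mul_assoc)
  then have XB: "X ** B = 0"
    using XE orth by (metis matrix_mul_assoc times0_right)
  have "conj_transpose B ** A = 0"
    using orth by (metis conj_transpose_0 conj_transpose_conj_transpose conj_transpose_mult)
  then have "B ** Y ** A = 0"
    by (metis BY(2) conj_transpose_mult matrix_mul_assoc times0_right)
  then have YA: "Y ** A = 0"
    using YE by (metis matrix_mul_assoc times0_right)
  have AY: "A ** Y = 0" using AB BY(1) by (metis matrix_mul_assoc times0_left)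
  have BX: "B ** X = 0" using BA AX(1) by (metis matrix_mul_assoc times0_left)
  have pow: "mat_pow (A + B) (Suc n) = mat_pow A (Suc n) + mat_pow B (Suc n)" for n
  proof (induction n)
    case (Suc n)
    then have "mat_pow (A + B) (Suc (Suc n)) = (A + B) ** (A ** mat_pow A n + B ** mat_pow B n)"
      by simp
    then show ?case using AB BA by (simp add: distrib matrix_mul_assoc)
  qed simp
  \<comment> \<open>A positive exponent is needed: \<open>pow\<close> fails for the zeroth power, where the left side is
    the identity and the right side would be twice the identity.\<close>
  define n where "n = Suc (max (mat_ind A) (mat_ind B))"
  have n: "X ** mat_pow A (Suc n) = mat_pow A n" "Y ** mat_pow B (Suc n) = mat_pow B n"
    using core_EP_mat_pow_beyond_ind[OF X, of n] core_EP_mat_pow_beyond_ind[OF Y, of n]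
    by (simp_all add: n_def del: mat_pow.simps)
  have "X ** mat_pow B (Suc n) = 0" "Y ** mat_pow A (Suc n) = 0"
    using XB YA by (simp_all add: matrix_mul_assoc)
  then have "(X + Y) ** mat_pow (A + B) (Suc n) = mat_pow A n + mat_pow B n"
    unfolding pow distrib using n by simp
  also have "\<dots> = mat_pow (A + B) n" unfolding n_def pow ..
  finally have "\<exists>n. (X + Y) ** mat_pow (A + B) (Suc n) = mat_pow (A + B) n" ..
  moreover have sum: "(A + B) ** (X + Y) = A ** X + B ** Y"
    using AY BX by (simp add: distrib)
  moreover have "(A + B) ** (X + Y) ** (X + Y) = X + Y"
  proof -
    have "X ** Y = 0" "Y ** X = 0"
      using XB YA AX(1) BY(1) by (metis matrix_mul_assoc times0_left)+
    then have "A ** X ** Y = 0" "B ** Y ** X = 0"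
      by (simp_all add: matrix_mul_assoc[symmetric])
    then show ?thesis
      using AX(1) BY(1) AY BX by (simp add: distrib)
  qed
  ultimately show ?thesis
    unfolding core_EP_mat_def using AX(2) BY(2) by (simp add: conj_transpose_add)
qed


section \<open>From tensors to frontal slices\<close>

lemma tslice_add: "tslice M (A + B) k = tslice M A k + tslice M B k"
  by (simp add: frontal_slice_def transform_def vec_eq_iff distrib_right sum.distrib)

lemma tslice_uminus: "tslice M (- A) k = - tslice M A k"
  by (simp add: frontal_slice_def transform_def vec_eq_iff sum_negf)

lemma tslice_0: "tslice M 0 k = 0"
  by (simp add: frontal_slice_def transform_def vec_eq_iff)

lemma tensor_eq_iff_tslice:
  assumes "invertible M"
  shows "A = B \<longleftrightarrow> (\<forall>k. tslice M A k = tslice M B k)"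
  using ex1_tslice[OF assms, of "tslice M B"] by auto

lemma tslice_mpow: "invertible M \<Longrightarrow> tslice M (mpow M A n) k = mat_pow (tslice M A k) n"
  by (induction n) (simp_all add: tslice_mprod tslice_mident)

lemma mat_ind_le_tubal_index: "mat_ind (tslice M A i) \<le> tubal_index M A"
  unfolding tubal_index_def by (intro Max_ge) auto

text \<open>The tubal index bounds the index of each slice, so every slice satisfies its equation at that
  common exponent as soon as it does at some exponent of its own.\<close>

lemma is_core_EP_inverse_iff_slices:
  assumes "invertible M"
  shows "is_core_EP_inverse M A X \<longleftrightarrow> (\<forall>i. core_EP_mat (tslice M A i) (tslice M X i))"
proof -
  have "is_core_EP_inverse M A X \<longleftrightarrow>
      (\<forall>i. tslice M X i ** mat_pow (tslice M A i) (Suc (tubal_index M A)) =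
             mat_pow (tslice M A i) (tubal_index M A) \<and>
           tslice M A i ** tslice M X i ** tslice M X i = tslice M X i \<and>
           conj_transpose (tslice M A i ** tslice M X i) = tslice M A i ** tslice M X i)"
    unfolding is_core_EP_inverse_def tensor_eq_iff_tslice[OF assms]
    by (simp add: assms tslice_mprod tslice_mctrans tslice_mpow tslice_mident numeral_2_eq_2 matrix_mul_assoc) 
      auto
  also have "\<dots> \<longleftrightarrow> (\<forall>i. core_EP_mat (tslice M A i) (tslice M X i))"
    using core_EP_mat_pow_beyond_ind[OF _ mat_ind_le_tubal_index]
    unfolding core_EP_mat_def by blast
  finally show ?thesis .
qed

text \<open>The slicewise core-EP inverses assemble to a tensor because the transform is bijective; this
  makes the definite description meaningful.\<close>

lemma core_EP_inverse_eq_iff: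
  assumes "invertible M"
  shows "core_EP_inverse M A = X \<longleftrightarrow> (\<forall>i. core_EP_mat (tslice M A i) (tslice M X i))"
proof -
  have "\<forall>i. \<exists>T. core_EP_mat (tslice M A i) T"
    using core_EP_mat_exists by blast
  from choice[OF this] obtain S where S: "\<And>i. core_EP_mat (tslice M A i) (S i)"
    by blast
  obtain Y where Y: "\<forall>i. tslice M Y i = S i"
    using ex1_tslice[OF assms, of S] by blast
  have unique: "X = Y" if "is_core_EP_inverse M A X" for X
    using that S Y unfolding is_core_EP_inverse_iff_slices[OF assms] tensor_eq_iff_tslice[OF assms]
    by (metis core_EP_mat_unique)
  have "is_core_EP_inverse M A Y"
    using S Y by (simp add: is_core_EP_inverse_iff_slices[OF assms])
  then have "core_EP_inverse M A = Y"
    unfolding core_EP_inverse_def using unique by (rule the_equality)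
  then show ?thesis
    using unique \<open>is_core_EP_inverse M A Y\<close>
    by (metis is_core_EP_inverse_iff_slices[OF assms])
qed

theorem theorem4p7:
  fixes M :: "complex^'p^'p"
    and A B :: "complex^'p^'m^'m"
    and k1 k2 :: nat
  assumes "invertible M"
    and "tubal_index M A = k1"
    and "tubal_index M B = k2"
    and "mprod M A B = 0"
    and "mprod M B A = 0"
    and "mprod M (mctrans M A) B = 0"
  shows "core_EP_inverse M (A + B) = core_EP_inverse M A + core_EP_inverse M B \<and>
         core_EP_inverse M (A - B) = core_EP_inverse M A - core_EP_inverse M B"
proof -
  note M = \<open>invertible M\<close>
  have orth: "tslice M A i ** tslice M B i = 0" "tslice M B i ** tslice M A i = 0"
    "conj_transpose (tslice M A i) ** tslice M B i = 0" for i
    using assms(4-6) M by (metis tslice_mprod tslice_mctrans tslice_0)+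
  have neg: "S ** T = 0 \<Longrightarrow> S ** - T = 0" "T ** S = 0 \<Longrightarrow> - T ** S = 0"
    for S T :: "complex^'m^'m"
    by (simp_all add: matrix_matrix_mult_def vec_eq_iff sum_negf)
  have A: "core_EP_mat (tslice M A i) (tslice M (core_EP_inverse M A) i)"
    and B: "core_EP_mat (tslice M B i) (tslice M (core_EP_inverse M B) i)" for i
    using core_EP_inverse_eq_iff[OF M] by blast+
  have "core_EP_inverse M (A + B) = core_EP_inverse M A + core_EP_inverse M B"
    unfolding core_EP_inverse_eq_iff[OF M] tslice_add
    using core_EP_mat_add[OF A B orth] by blast
  moreover have "core_EP_inverse M (A + - B) = core_EP_inverse M A + - core_EP_inverse M B"
    unfolding core_EP_inverse_eq_iff[OF M] tslice_add tslice_uminus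
    using core_EP_mat_add[OF A core_EP_mat_uminus[OF B]] orth neg by blast
  ultimately show ?thesis by simp
qed

end
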